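(* Let $\mathcal G=(G_n,\|\cdot\|_n)_{n\in\mathbb N}$ be a family of metric groups with $\sup\{\|g\|_n : n\in\mathbb N,\ g\in G_n\}<\infty$ and let $\mathcal U$ be a non-principal ultrafilter on $\mathbb N$. If $\mathcal G^*_{\mathrm{met}}=\bigcup_{m\in\mathbb N}X_m$, where each $X_m$ is a metrically internal subset of $\mathcal G^*_{\mathrm{met}}$, then there is $N\in\mathbb N$ such that $$\mathcal G^*_{\mathrm{met}}=\left(X_0\cup\ldots\cup X_N\right)^2 .$$
   Context: A metric group $(G,\|\cdot\|)$ is a group with a bi-invariant norm $\|\cdot\|\colon G\to[0,\infty]$: $\|e\|=0$, $\|gh\|\le\|g\|+\|h\|$, $\|g^{-1}\|=\|g\|=\|hgh^{-1}\|$, and $\|g\|=0$ iff $g=e$. The metric ultraproduct is $\mathcal G^*_{\mathrm{met}}=\prod_{n}G_n/\mathcal E$, where $\mathcal E=\{(g_n)\in\prod_n G_n : \lim_{n\to\mathcal U}\|g_n\|_n=0\}$, with norm $\|(g_n)/\mathcal E\|=\lim_{n\to\mathcal U}\|g_n\|_n$. A subset $X\subseteq\mathcal G^*_{\mathrm{met}}$ is metrically internal if there are $Y_n\subseteq G_n$ ($n\in\mathbb N$) such that $X$ is the image of $\prod_nY_n$ in $\mathcal G^*_{\mathrm{met}}$. For a subset $Y$ of a group, $Y^2=\{ab : a,b\in Y\}$. *)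

theory Defs
  imports "HOL-Analysis.Analysis" "HOL-Algebra.Product_Groups"
begin

locale metric_group = group +
  fixes nrm :: "'a \<Rightarrow> ennreal"
  assumes nrm_one: "nrm \<one> = 0"
    and nrm_mult: "\<lbrakk>g \<in> carrier G; h \<in> carrier G\<rbrakk> \<Longrightarrow> nrm (g \<otimes> h) \<le> nrm g + nrm h"
    and nrm_inv: "g \<in> carrier G \<Longrightarrow> nrm (inv g) = nrm g"
    and nrm_conj: "\<lbrakk>g \<in> carrier G; h \<in> carrier G\<rbrakk> \<Longrightarrow> nrm (h \<otimes> g \<otimes> inv h) = nrm g"
    and nrm_eq_0_iff: "g \<in> carrier G \<Longrightarrow> nrm g = 0 \<longleftrightarrow> g = \<one>"

text \<open>
  The nonnegative extended reals are compact Hausdorff, so every sequence of norms converges along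
  an ultrafilter. Filters are sets of predicates here; the principal ultrafilter at \<open>i\<close> is
  \<open>principal {i}\<close>.
\<close>

definition ultrafilter :: "'i filter \<Rightarrow> bool" where
  "ultrafilter U \<longleftrightarrow> U \<noteq> bot \<and> (\<forall>P. eventually P U \<or> eventually (\<lambda>x. \<not> P x) U)"

definition nonprincipal_ultrafilter :: "'i filter \<Rightarrow> bool" where
  "nonprincipal_ultrafilter U \<longleftrightarrow> ultrafilter U \<and> (\<forall>i. U \<noteq> principal {i})"

definition null_sequences ::
  "nat filter \<Rightarrow> (nat \<Rightarrow> ('a, 'm) monoid_scheme) \<Rightarrow> (nat \<Rightarrow> 'a \<Rightarrow> ennreal) \<Rightarrow> (nat \<Rightarrow> 'a) set" where
  "null_sequences U G nrm =
     {g \<in> carrier (product_group UNIV G). ((\<lambda>n. nrm n (g n)) \<longlongrightarrow> 0) U}"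

text \<open>
  All groups of a sequence live on one element type; this loses no generality, as arbitrary groups
  can be transported to subsets of the disjoint union of their carriers.
\<close>

definition metric_ultraproduct ::
  "nat filter \<Rightarrow> (nat \<Rightarrow> ('a, 'm) monoid_scheme) \<Rightarrow> (nat \<Rightarrow> 'a \<Rightarrow> ennreal)
    \<Rightarrow> (nat \<Rightarrow> 'a) set monoid" where
  "metric_ultraproduct U G nrm = product_group UNIV G Mod null_sequences U G nrm"

definition ultraproduct_class ::
  "nat filter \<Rightarrow> (nat \<Rightarrow> ('a, 'm) monoid_scheme) \<Rightarrow> (nat \<Rightarrow> 'a \<Rightarrow> ennreal)
    \<Rightarrow> (nat \<Rightarrow> 'a) \<Rightarrow> (nat \<Rightarrow> 'a) set" where
  "ultraproduct_class U G nrm g = null_sequences U G nrm #>\<^bsub>product_group UNIV G\<^esub> g"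

definition metrically_internal ::
  "nat filter \<Rightarrow> (nat \<Rightarrow> ('a, 'm) monoid_scheme) \<Rightarrow> (nat \<Rightarrow> 'a \<Rightarrow> ennreal)
    \<Rightarrow> (nat \<Rightarrow> 'a) set set \<Rightarrow> bool" where
  "metrically_internal U G nrm X \<longleftrightarrow>
     (\<exists>Y. (\<forall>n. Y n \<subseteq> carrier (G n)) \<and> X = ultraproduct_class U G nrm ` (\<Pi>\<^sub>E n\<in>UNIV. Y n))"

text \<open>
  \<open>Mod\<close> makes sense for arbitrary sets; the next two lemmas show that the metric ultraproduct
  really is a quotient by a normal subgroup.
\<close>

lemma null_sequences_normal:
  assumes G: "\<And>n. metric_group (G n) (nrm n)"
  shows "null_sequences U G nrm \<lhd> product_group UNIV G"
proof -
  have gr: "\<And>n. group (G n)"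
    using G by (simp add: metric_group_def)
  interpret P: group "product_group UNIV G"
    using gr by simp
  have sub: "subgroup (null_sequences U G nrm) (product_group UNIV G)"
  proof (rule P.subgroupI)
    show "null_sequences U G nrm \<subseteq> carrier (product_group UNIV G)"
      by (auto simp: null_sequences_def)
    have "\<one>\<^bsub>product_group UNIV G\<^esub> \<in> null_sequences U G nrm"
      using P.one_closed by (simp add: null_sequences_def metric_group.nrm_one[OF G])
    then show "null_sequences U G nrm \<noteq> {}"
      by blast
  next
    fix a assume a: "a \<in> null_sequences U G nrm"
    then have ac: "a \<in> (\<Pi>\<^sub>E n\<in>UNIV. carrier (G n))"
      by (simp add: null_sequences_def)
    then have "nrm n (inv\<^bsub>G n\<^esub> a n) = nrm n (a n)" for n
      by (intro metric_group.nrm_inv[OF G]) auto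
    then show "inv\<^bsub>product_group UNIV G\<^esub> a \<in> null_sequences U G nrm"
      using a P.inv_closed[of a] by (simp add: null_sequences_def inv_product_group[OF ac gr])
  next
    fix a b assume a: "a \<in> null_sequences U G nrm" and b: "b \<in> null_sequences U G nrm"
    then have ac: "a \<in> carrier (product_group UNIV G)" "b \<in> carrier (product_group UNIV G)"
      by (auto simp: null_sequences_def)
    then have le: "nrm n (a n \<otimes>\<^bsub>G n\<^esub> b n) \<le> nrm n (a n) + nrm n (b n)" for n
      by (intro metric_group.nrm_mult[OF G]) auto
    have "((\<lambda>n. nrm n (a n) + nrm n (b n)) \<longlongrightarrow> 0 + 0) U"
      using a b by (intro tendsto_add) (auto simp: null_sequences_def)
    then have lim: "((\<lambda>n. nrm n (a n) + nrm n (b n)) \<longlongrightarrow> 0) U"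
      by simp
    have "((\<lambda>n. nrm n (a n \<otimes>\<^bsub>G n\<^esub> b n)) \<longlongrightarrow> 0) U"
      by (rule tendsto_sandwich[OF _ _ tendsto_const lim]) (simp_all add: le)
    then show "a \<otimes>\<^bsub>product_group UNIV G\<^esub> b \<in> null_sequences U G nrm"
      using P.m_closed[OF ac] by (simp add: null_sequences_def)
  qed
  moreover have "x \<otimes>\<^bsub>product_group UNIV G\<^esub> h \<otimes>\<^bsub>product_group UNIV G\<^esub> inv\<^bsub>product_group UNIV G\<^esub> x
      \<in> null_sequences U G nrm"
    if x: "x \<in> carrier (product_group UNIV G)" and h: "h \<in> null_sequences U G nrm" for x h
  proof -
    have hc: "h \<in> carrier (product_group UNIV G)"
      using h by (simp add: null_sequences_def)
    have xc: "x \<in> (\<Pi>\<^sub>E n\<in>UNIV. carrier (G n))"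
      using x by simp
    have "nrm n (x n \<otimes>\<^bsub>G n\<^esub> h n \<otimes>\<^bsub>G n\<^esub> inv\<^bsub>G n\<^esub> x n) = nrm n (h n)" for n
      using x hc by (intro metric_group.nrm_conj[OF G]) auto
    then show ?thesis
      using h P.m_closed[OF P.m_closed[OF x hc] P.inv_closed[OF x]]
      by (simp add: null_sequences_def inv_product_group[OF xc gr])
  qed
  ultimately show ?thesis
    unfolding P.normal_inv_iff by blast
qed

lemma metric_ultraproduct_group:
  assumes "\<And>n. metric_group (G n) (nrm n)"
  shows "group (metric_ultraproduct U G nrm)"
  unfolding metric_ultraproduct_def
  using null_sequences_normal[of G nrm U] assms by (intro normal.factorgroup_is_group) auto

end

theory Submission
  imports Defs
begin

text \<open>
  Metrically internal sets are closed, and countably many internal conditions that are finitely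
  satisfiable are simultaneously satisfiable (\<open>\<aleph>\<^sub>1\<close>-saturation). Put
  \<open>Z\<^sub>m = X\<^sub>0 \<union> \<dots> \<union> X\<^sub>m\<close>. As in the Baire category theorem, some \<open>Z\<^sub>M\<close> contains a
  ball of radius \<open>\<epsilon>\<close> around some \<open>a\<close>. On the other hand some \<open>Z\<^sub>m\<close>, with \<open>m \<ge> M\<close>, is
  \<open>\<epsilon>\<close>-dense: otherwise saturation yields a point at distance at least \<open>\<epsilon>\<close> from all \<open>Z\<^sub>m\<close>.
  Given \<open>g\<close>, choose \<open>w \<in> Z\<^sub>m\<close> at distance less than \<open>\<epsilon>\<close> from \<open>g a\<^sup>-\<^sup>1\<close>; by
  bi-invariance \<open>w\<^sup>-\<^sup>1 g\<close> lies in the ball around \<open>a\<close>, so \<open>g = w (w\<^sup>-\<^sup>1 g) \<in> Z\<^sub>m\<^sup>2\<close>.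
\<close>

section \<open>Distances in metric groups\<close>

context metric_group
begin

definition mdist :: "'a \<Rightarrow> 'a \<Rightarrow> ennreal" where
  "mdist x y = nrm (x \<otimes> inv y)"

lemma mdist_self: "x \<in> carrier G \<Longrightarrow> mdist x x = 0"
  by (simp add: mdist_def nrm_one)

lemma mdist_commute:
  assumes "x \<in> carrier G" "y \<in> carrier G"
  shows "mdist x y = mdist y x"
  using nrm_inv[of "x \<otimes> inv y"] assms by (simp add: mdist_def inv_mult_group)

lemma mdist_triangle:
  assumes "x \<in> carrier G" "y \<in> carrier G" "z \<in> carrier G"
  shows "mdist x z \<le> mdist x y + mdist y z"
proof -
  have "x \<otimes> inv z = (x \<otimes> inv y) \<otimes> (y \<otimes> inv z)"
    using assms by (simp add: m_assoc inv_solve_left)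
  then show ?thesis
    using nrm_mult[of "x \<otimes> inv y" "y \<otimes> inv z"] assms by (simp add: mdist_def)
qed

text \<open>\<open>inv w \<otimes> g \<otimes> inv a\<close> is a conjugate of
  \<open>g \<otimes> inv a \<otimes> inv w\<close>, so the two have the same norm.\<close>

lemma mdist_left_quotient:
  assumes "g \<in> carrier G" "w \<in> carrier G" "a \<in> carrier G"
  shows "mdist (inv w \<otimes> g) a = mdist (g \<otimes> inv a) w"
proof -
  have "inv w \<otimes> g \<otimes> inv a = inv w \<otimes> (g \<otimes> inv a \<otimes> inv w) \<otimes> inv (inv w)"
    using assms by (simp add: m_assoc)
  then show ?thesis
    using nrm_conj[of "g \<otimes> inv a \<otimes> inv w" "inv w"] assms by (simp add: mdist_def)
qed

end

section \<open>Saturation\<close>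

lemma ultrafilter_not_eventually:
  assumes "ultrafilter U"
  shows "(\<not> eventually P U) \<longleftrightarrow> eventually (\<lambda>x. \<not> P x) U"
proof
  assume "eventually (\<lambda>x. \<not> P x) U"
  moreover have "eventually (\<lambda>x. False) U" if "eventually (\<lambda>x. \<not> P x) U" "eventually P U"
    using eventually_conj[OF that] by simp
  ultimately show "\<not> eventually P U"
    using assms by (auto simp: ultrafilter_def trivial_limit_def)
qed (use assms in \<open>auto simp: ultrafilter_def\<close>)

text \<open>If \<open>{i}\<close> belonged to the ultrafilter, it would be principal at
  \<open>i\<close>. So each single index can be excluded, and hence each finite initial
  segment.\<close>

lemma nonprincipal_ultrafilter_eventually_ge:
  fixes U :: "nat filter"
  assumes "nonprincipal_ultrafilter U"
  shows "eventually (\<lambda>n. m \<le> n) U"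
proof -
  have uf: "ultrafilter U"
    using assms by (simp add: nonprincipal_ultrafilter_def)
  have ne: "eventually (\<lambda>n. n \<noteq> i) U" for i
  proof (rule ccontr)
    assume "\<not> eventually (\<lambda>n. n \<noteq> i) U"
    then have ev: "eventually (\<lambda>n. n = i) U"
      using ultrafilter_not_eventually[OF uf, of "\<lambda>n. n \<noteq> i"] by simp
    have "eventually P U \<longleftrightarrow> P i" for P
    proof
      assume "eventually P U"
      then show "P i"
        using ev ultrafilter_not_eventually[OF uf, of P] by (metis (mono_tags, lifting) eventually_mono)
    next
      assume "P i"
      then show "eventually P U"
        using ev by (auto elim: eventually_mono)
    qed
    then have "U = principal {i}"
      by (simp add: filter_eq_iff eventually_principal)
    then show False
      using assms by (simp add: nonprincipal_ultrafilter_def)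
  qed
  have "eventually (\<lambda>n. \<forall>i\<in>{..<m}. n \<noteq> i) U"
    by (rule eventually_ball_finite) (auto simp: ne)
  then show ?thesis
    by (rule eventually_mono) (metis lessThan_iff not_le_imp_less)
qed

text \<open>Diagonal argument: \<open>b n\<close> meets as long an initial run of conditions as
  possible, up to length \<open>n\<close>. Any given condition is then met at U-many indices,
  because U contains all tails.\<close>

lemma saturation:
  fixes P :: "nat \<Rightarrow> nat \<Rightarrow> 'b \<Rightarrow> bool"
  assumes U: "nonprincipal_ultrafilter U"
    and C: "\<And>n. C n \<noteq> {}"
    and fin: "\<And>m. \<forall>\<^sub>F n in U. \<exists>x\<in>C n. \<forall>j\<le>m. P j n x"
  obtains b where "\<And>n. b n \<in> C n" "\<And>m. \<forall>\<^sub>F n in U. P m n (b n)"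
proof -
  \<comment> \<open>The cap \<open>m \<le> n\<close> makes a greatest run length exist. The strict
    \<open>j < m\<close> makes length 0 always possible, as \<open>C n\<close> is nonempty.\<close>
  define Q where "Q n m \<longleftrightarrow> m \<le> n \<and> (\<exists>x\<in>C n. \<forall>j<m. P j n x)" for n m
  define k where "k n = (GREATEST m. Q n m)" for n
  have Q0: "Q n 0" for n
    using C by (auto simp: Q_def)
  have bound: "Q n m \<Longrightarrow> m \<le> n" for n m
    by (simp add: Q_def)
  have Qk: "Q n (k n)" for n
    unfolding k_def using Q0 bound by (rule GreatestI_nat)
  have le_k: "m \<le> k n" if "Q n m" for n m
    unfolding k_def using that bound by (rule Greatest_le_nat)
  have "\<forall>n. \<exists>x\<in>C n. \<forall>j<k n. P j n x"
    using Qk by (simp add: Q_def)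
  then obtain b where b: "\<And>n. b n \<in> C n" "\<And>n j. j < k n \<Longrightarrow> P j n (b n)"
    by metis
  have "\<forall>\<^sub>F n in U. P m n (b n)" for m
    using nonprincipal_ultrafilter_eventually_ge[OF U, of "Suc m"] fin[of m]
  proof eventually_elim
    case (elim n)
    then have "Q n (Suc m)"
      by (auto simp: Q_def less_Suc_eq_le)
    then show ?case
      using b(2)[of m n] le_k[of n "Suc m"] by simp
  qed
  with b(1) show ?thesis
    by (rule that)
qed

lemma ennreal_add_less_halves:
  fixes x y z :: ennreal
  assumes "x < z / 2" "y < z / 2"
  shows "x + y < z"
proof (cases z rule: ennreal_cases)
  case (real r)
  then have "z / 2 = ennreal (r / 2)"
    by (simp add: divide_ennreal[symmetric])
  with assms have "x + y < ennreal (r / 2 + r / 2)"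
    using add_mono_ennreal by metis
  then show ?thesis
    using real by simp
next
  \<comment> \<open>Half of infinity is infinity, so \<open>x\<close> and \<open>y\<close> are
    finite, and so is their sum.\<close>
  case top
  then show ?thesis
    using assms by (auto simp: ennreal_top_divide less_top)
qed

section \<open>Metric ultraproducts\<close>

locale metric_group_sequence =
  fixes G :: "nat \<Rightarrow> ('a, 'm) monoid_scheme"
    and nrm :: "nat \<Rightarrow> 'a \<Rightarrow> ennreal"
    and U :: "nat filter"
  assumes metric_group: "\<And>n. metric_group (G n) (nrm n)"
    and nonprincipal: "nonprincipal_ultrafilter U"
begin

abbreviation P where "P \<equiv> product_group UNIV G"
abbreviation cls where "cls \<equiv> ultraproduct_class U G nrm"
abbreviation d where "d n \<equiv> metric_group.mdist (G n) (nrm n)"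

section \<open>Equality and products of classes\<close>

lemma group_component: "group (G n)"
  using metric_group by (simp add: metric_group_def)

lemma group_P: "group P"
  using group_component by simp

lemma carrier_component_nonempty: "carrier (G n) \<noteq> {}"
  using group.is_monoid[OF group_component] monoid.one_closed by blast

lemma carrier_P_iff: "g \<in> carrier P \<longleftrightarrow> (\<forall>n. g n \<in> carrier (G n))"
  by auto

lemma component_closed: "g \<in> carrier P \<Longrightarrow> g n \<in> carrier (G n)"
  using carrier_P_iff by blast

lemma ultrafilter: "ultrafilter U"
  using nonprincipal by (simp add: nonprincipal_ultrafilter_def)

lemmas not_eventually = ultrafilter_not_eventually[OF ultrafilter]

lemma eventually_const_False: "\<not> (\<forall>\<^sub>F n in U. False)"
  using ultrafilter by (simp add: ultrafilter_def trivial_limit_def)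

lemma mult_P: "(a \<otimes>\<^bsub>P\<^esub> b) n = a n \<otimes>\<^bsub>G n\<^esub> b n"
  by simp

lemma inv_P: "a \<in> carrier P \<Longrightarrow> (inv\<^bsub>P\<^esub> a) n = inv\<^bsub>G n\<^esub> (a n)"
  using inv_product_group[of a UNIV G] group_component by simp

lemma class_eq_iff:
  assumes "a \<in> carrier P" "b \<in> carrier P"
  shows "cls a = cls b \<longleftrightarrow> ((\<lambda>n. d n (a n) (b n)) \<longlongrightarrow> 0) U"
proof -
  interpret P: group P
    by (rule group_P)
  interpret N: normal "null_sequences U G nrm" P
    by (rule null_sequences_normal) (rule metric_group)
  \<comment> \<open>Right cosets coincide as soon as one contains a representative of the
    other.\<close>
  have "cls a = cls b \<longleftrightarrow> a \<in> null_sequences U G nrm #>\<^bsub>P\<^esub> b"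
    unfolding ultraproduct_class_def
    using assms P.rcos_self[OF _ N.subgroup_axioms] P.repr_independence[OF _ _ N.subgroup_axioms]
    by metis
  also have "\<dots> \<longleftrightarrow> a \<otimes>\<^bsub>P\<^esub> inv\<^bsub>P\<^esub> b \<in> null_sequences U G nrm"
    using assms by (intro N.rcos_module) (simp_all add: group_P)
  also have "\<dots> \<longleftrightarrow> ((\<lambda>n. d n (a n) (b n)) \<longlongrightarrow> 0) U"
    using P.m_closed[OF assms(1) P.inv_closed[OF assms(2)]] inv_P[OF assms(2)]
    by (simp add: null_sequences_def metric_group.mdist_def[OF metric_group])
  finally show ?thesis .
qed

lemma class_mult:
  assumes "a \<in> carrier P" "b \<in> carrier P"
  shows "cls a \<otimes>\<^bsub>metric_ultraproduct U G nrm\<^esub> cls b = cls (a \<otimes>\<^bsub>P\<^esub> b)"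
proof -
  interpret N: normal "null_sequences U G nrm" P
    by (rule null_sequences_normal) (rule metric_group)
  show ?thesis
    using N.rcos_sum[OF assms] by (simp add: ultraproduct_class_def metric_ultraproduct_def)
qed

lemma carrier_metric_ultraproduct: "carrier (metric_ultraproduct U G nrm) = cls ` carrier P"
  by (auto simp: metric_ultraproduct_def FactGroup_def RCOSETS_def ultraproduct_class_def)

section \<open>Internal sets are closed\<close>

text \<open>Positive distance from an internal set, expressed on representatives. An empty
  \<open>Y n\<close> imposes no condition at \<open>n\<close>.\<close>

definition far :: "(nat \<Rightarrow> 'a set) \<Rightarrow> (nat \<Rightarrow> 'a) \<Rightarrow> bool" where
  "far Y g \<longleftrightarrow> (\<exists>e>0. \<forall>\<^sub>F n in U. \<forall>w\<in>Y n. e \<le> d n (g n) w)"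

lemma not_far_self:
  assumes "g \<in> carrier P" "\<forall>\<^sub>F n in U. g n \<in> Y n"
  shows "\<not> far Y g"
proof
  assume "far Y g"
  then obtain e where e: "e > 0" "\<forall>\<^sub>F n in U. \<forall>w\<in>Y n. e \<le> d n (g n) w"
    by (auto simp: far_def)
  have "\<forall>\<^sub>F n in U. False"
    using e(2) assms(2)
  proof eventually_elim
    case (elim n)
    then have "e \<le> d n (g n) (g n)"
      by blast
    then show False
      using e(1) assms(1) metric_group.mdist_self[OF metric_group, of "g n" n]
      unfolding carrier_P_iff by simp
  qed
  then show False
    using eventually_const_False by simp
qed

text \<open>The minimum of finitely many positive bounds is positive. This lets finite unions of
  internal sets be formed componentwise.\<close>

lemma far_UN_iff:
  assumes "finite I"
  shows "far (\<lambda>n. \<Union>k\<in>I. Y k n) g \<longleftrightarrow> (\<forall>k\<in>I. far (Y k) g)"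
proof
  assume "far (\<lambda>n. \<Union>k\<in>I. Y k n) g"
  then obtain e where e: "e > 0" "\<forall>\<^sub>F n in U. \<forall>w\<in>(\<Union>k\<in>I. Y k n). e \<le> d n (g n) w"
    by (auto simp: far_def)
  have "\<forall>\<^sub>F n in U. \<forall>w\<in>Y k n. e \<le> d n (g n) w" if "k \<in> I" for k
    using e(2) by (rule eventually_mono) (use that in blast)
  then show "\<forall>k\<in>I. far (Y k) g"
    using e(1) by (auto simp: far_def)
next
  assume "\<forall>k\<in>I. far (Y k) g"
  with assms show "far (\<lambda>n. \<Union>k\<in>I. Y k n) g"
  proof (induction I)
    case empty
    then show ?case
      by (auto simp: far_def intro: exI[of _ 1])
  next
    case (insert k I)
    then obtain e e' where e: "e > 0" "\<forall>\<^sub>F n in U. \<forall>w\<in>Y k n. e \<le> d n (g n) w"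
      and e': "e' > 0" "\<forall>\<^sub>F n in U. \<forall>w\<in>(\<Union>k\<in>I. Y k n). e' \<le> d n (g n) w"
      by (auto simp: far_def)
    have "\<forall>\<^sub>F n in U. \<forall>w\<in>(\<Union>k\<in>insert k I. Y k n). min e e' \<le> d n (g n) w"
      using e(2) e'(2) by eventually_elim (auto simp: min_le_iff_disj)
    moreover have "min e e' > 0"
      using e(1) e'(1) by simp
    ultimately show ?case
      unfolding far_def by blast
  qed
qed

text \<open>Closedness of internal sets. If \<open>g\<close> is not far, \<open>Y n\<close> has
  points within each fixed radius of \<open>g n\<close> for U-many \<open>n\<close>; saturation
  merges these approximations into one sequence at limit distance 0.\<close>

lemma class_image_iff_not_far:
  assumes Y: "\<And>n. Y n \<subseteq> carrier (G n)" "\<And>n. Y n \<noteq> {}"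
    and g: "g \<in> carrier P"
  shows "cls g \<in> cls ` (\<Pi>\<^sub>E n\<in>UNIV. Y n) \<longleftrightarrow> \<not> far Y g"
proof
  assume "cls g \<in> cls ` (\<Pi>\<^sub>E n\<in>UNIV. Y n)"
  then obtain w where w: "\<And>n. w n \<in> Y n" "cls g = cls w"
    by auto
  then have "w \<in> carrier P"
    using Y(1) by (auto simp: carrier_P_iff)
  then have lim: "((\<lambda>n. d n (g n) (w n)) \<longlongrightarrow> 0) U"
    using class_eq_iff g w(2) by blast
  show "\<not> far Y g"
  proof
    assume "far Y g"
    then obtain e where e: "e > 0" "\<forall>\<^sub>F n in U. \<forall>w\<in>Y n. e \<le> d n (g n) w"
      by (auto simp: far_def)
    have "\<forall>\<^sub>F n in U. d n (g n) (w n) < e"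
      using lim e(1) by (rule order_tendstoD)
    then have "\<forall>\<^sub>F n in U. False"
      using e(2) by eventually_elim (use w(1) in \<open>auto simp: not_le[symmetric]\<close>)
    then show False
      using eventually_const_False by simp
  qed
next
  assume nf: "\<not> far Y g"
  define r where "r j = ennreal (inverse (real (Suc j)))" for j
  have r0: "r j > 0" for j
    by (simp add: r_def)
  have r_mono: "r m \<le> r j" if "j \<le> m" for j m
    using that by (auto simp: r_def intro!: ennreal_leI le_imp_inverse_le)
  have "\<forall>\<^sub>F n in U. \<exists>x\<in>Y n. \<forall>j\<le>m. d n (g n) x < r j" for m
  proof -
    \<comment> \<open>For an ultrafilter, failing to hold eventually is the same as eventually
      failing.\<close>
    have "\<forall>\<^sub>F n in U. \<not> (\<forall>w\<in>Y n. r m \<le> d n (g n) w)"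
      unfolding not_eventually[symmetric] using nf r0[of m] unfolding far_def by blast
    then show ?thesis
      by eventually_elim (use r_mono in \<open>auto simp: not_le intro: less_le_trans\<close>)
  qed
  with nonprincipal Y(2)
  obtain w where w: "\<And>n. w n \<in> Y n" "\<And>m. \<forall>\<^sub>F n in U. d n (g n) (w n) < r m"
    by (rule saturation[where P = "\<lambda>j n x. d n (g n) x < r j"]) blast
  have wP: "w \<in> carrier P"
    using w(1) Y(1) by (auto simp: carrier_P_iff)
  have "((\<lambda>n. d n (g n) (w n)) \<longlongrightarrow> 0) U"
  proof (rule order_tendstoI)
    fix e :: ennreal assume "e > 0"
    then obtain m where "r m < e"
      using reals_Archimedean by (cases e) (auto simp: r_def ennreal_less_iff)
    show "\<forall>\<^sub>F n in U. d n (g n) (w n) < e"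
      using w(2)[of m] by eventually_elim (use \<open>r m < e\<close> in simp)
  qed simp
  then have "cls g = cls w"
    using class_eq_iff g wP by blast
  then show "cls g \<in> cls ` (\<Pi>\<^sub>E n\<in>UNIV. Y n)"
    using w(1) by auto
qed

lemma metrically_internal_not_far:
  assumes "metrically_internal U G nrm X"
  shows "\<exists>Y. (\<forall>n. Y n \<subseteq> carrier (G n)) \<and> (\<forall>g\<in>carrier P. cls g \<in> X \<longleftrightarrow> \<not> far Y g)"
proof -
  obtain Y where Y: "\<And>n. Y n \<subseteq> carrier (G n)" "X = cls ` (\<Pi>\<^sub>E n\<in>UNIV. Y n)"
    using assms by (auto simp: metrically_internal_def)
  show ?thesis
  proof (cases "\<exists>n. Y n = {}")
    \<comment> \<open>One empty component already empties the product, whereas \<open>far\<close>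
      ignores single indices. So \<open>Y\<close> is replaced by the family with all components
      empty, from which everything is far.\<close>
    case True
    then have "(\<Pi>\<^sub>E n\<in>UNIV. Y n) = {}"
      by (simp add: PiE_eq_empty_iff)
    then have "X = {}"
      using Y(2) by simp
    then show ?thesis
      by (intro exI[of _ "\<lambda>_. {}"]) (auto simp: far_def intro: exI[of _ 1])
  next
    case False
    then have "Y n \<noteq> {}" for n
      by blast
    then have "cls g \<in> X \<longleftrightarrow> \<not> far Y g" if "g \<in> carrier P" for g
      unfolding Y(2) using Y(1) that by (intro class_image_iff_not_far)
    then show ?thesis
      using Y(1) by (intro exI[of _ Y]) simp
  qed
qed

section \<open>Density and Baire category\<close>

text \<open>Otherwise each \<open>W m\<close> is missed by distance \<open>e\<close> on U-many
  components. As \<open>e\<close> is the same for all \<open>m\<close>, saturation gives one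
  sequence far from every \<open>W m\<close>, against the cover.\<close>

lemma eventually_dense:
  fixes W :: "nat \<Rightarrow> nat \<Rightarrow> 'a set"
  assumes mono: "\<And>m n. W m n \<subseteq> W (Suc m) n"
    and cover: "\<And>g. g \<in> carrier P \<Longrightarrow> \<exists>m. \<not> far (W m) g"
    and "e > 0"
  obtains m where "\<forall>\<^sub>F n in U. \<forall>h\<in>carrier (G n). \<exists>w\<in>W m n. d n h w < e"
proof (rule ccontr)
  assume "\<not> thesis"
  then have no: "\<not> (\<forall>\<^sub>F n in U. \<forall>h\<in>carrier (G n). \<exists>w\<in>W m n. d n h w < e)" for m
    using that by blast
  have W_mono: "W j n \<subseteq> W m n" if "j \<le> m" for j m n
    using mono that by (rule lift_Suc_mono_le[of "\<lambda>m. W m n"])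
  \<comment> \<open>Since the sets increase, a point that misses \<open>W m\<close> by
    \<open>e\<close> also misses all earlier ones.\<close>
  have "\<forall>\<^sub>F n in U. \<exists>h\<in>carrier (G n). \<forall>j\<le>m. \<forall>w\<in>W j n. e \<le> d n h w" for m
    using no[of m] unfolding not_eventually
    by eventually_elim (use W_mono in \<open>auto simp: not_less, blast\<close>)
  with nonprincipal carrier_component_nonempty
  obtain h where h: "\<And>n. h n \<in> carrier (G n)" "\<And>m. \<forall>\<^sub>F n in U. \<forall>w\<in>W m n. e \<le> d n (h n) w"
    by (rule saturation[where P = "\<lambda>m n x. \<forall>w\<in>W m n. e \<le> d n x w"]) blast
  then have "far (W m) h" for m
    using \<open>e > 0\<close> by (auto simp: far_def)
  then show False
    using cover[of h] h(1) by (auto simp: carrier_P_iff)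
qed

text \<open>If no ball works, nested balls can be chosen so that the one numbered
  \<open>Suc m\<close> stays away from \<open>W m\<close>. Saturation, in place of completeness,
  supplies a point in all of them.\<close>

lemma baire_ball:
  fixes W :: "nat \<Rightarrow> nat \<Rightarrow> 'a set"
  assumes W: "\<And>m n. W m n \<subseteq> carrier (G n)"
    and cover: "\<And>g. g \<in> carrier P \<Longrightarrow> \<exists>m. \<not> far (W m) g"
  obtains m a e where "a \<in> carrier P" "e > 0"
    "\<And>b. b \<in> carrier P \<Longrightarrow> \<forall>\<^sub>F n in U. d n (b n) (a n) < e \<Longrightarrow> \<not> far (W m) b"
proof (rule ccontr)
  note ball = that
  assume "\<not> thesis"
  have no: "\<exists>b. b \<in> carrier P \<and> (\<forall>\<^sub>F n in U. d n (b n) (a n) < e) \<and> far (W m) b"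
    if "a \<in> carrier P" "e > 0" for a e m
    using that ball[OF that] \<open>\<not> thesis\<close> by (metis (no_types))
  define good where "good s \<longleftrightarrow> fst s \<in> carrier P \<and> snd s > 0" for s :: "(nat \<Rightarrow> 'a) \<times> ennreal"
  \<comment> \<open>Pairs are balls, given by centre and radius. The radius of \<open>t\<close>
    doubles as the lower bound on the distance to \<open>W m\<close>, so a sequence lying in
    \<open>t\<close> on U-many components is far from \<open>W m\<close>.\<close>
  define smaller where "smaller m s t \<longleftrightarrow> (\<forall>\<^sub>F n in U. \<forall>h\<in>carrier (G n). d n h (fst t n) < snd t \<longrightarrow>
      d n h (fst s n) < snd s \<and> (\<forall>w\<in>W m n. snd t \<le> d n h w))"
    for m and s t :: "(nat \<Rightarrow> 'a) \<times> ennreal"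
  have step: "\<exists>t. good t \<and> smaller m s t" if "good s" for m s
  proof -
    obtain a e where s: "s = (a, e)" "a \<in> carrier P" "e > 0"
      using \<open>good s\<close> by (cases s) (auto simp: good_def)
    then obtain b where b: "b \<in> carrier P" "\<forall>\<^sub>F n in U. d n (b n) (a n) < e / 2" "far (W m) b"
      using no[of a "e / 2" m] by (auto simp: ennreal_zero_less_divide)
    then obtain r where r: "r > 0" "\<forall>\<^sub>F n in U. \<forall>w\<in>W m n. r \<le> d n (b n) w"
      by (auto simp: far_def)
    \<comment> \<open>The bound \<open>e / 2\<close> keeps the new ball inside the old one, as
      \<open>b\<close> is within \<open>e / 2\<close> of \<open>a\<close>. With
      \<open>r / 2\<close>, a point of the new ball closer than \<open>q\<close> to
      \<open>W m\<close> would put \<open>b\<close> closer than \<open>r\<close> to it.\<close>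
    define q where "q = min (e / 2) (r / 2)"
    have "good (b, q)"
      using b(1) s(3) r(1) by (auto simp: good_def q_def ennreal_zero_less_divide)
    moreover have "smaller m s (b, q)"
      unfolding smaller_def using b(2) r(2)
    proof eventually_elim
      case (elim n)
      interpret metric_group "G n" "nrm n"
        by (rule metric_group)
      have c: "a n \<in> carrier (G n)" "b n \<in> carrier (G n)"
        using b(1) s(2) by (blast intro: component_closed)+
      show ?case
      proof (intro ballI impI conjI)
        fix h assume h: "h \<in> carrier (G n)" "d n h (fst (b, q) n) < snd (b, q)"
        then have hb: "d n h (b n) < e / 2" "d n h (b n) < r / 2"
          by (simp_all add: q_def)
        show "d n h (fst s n) < snd s"
          using ennreal_add_less_halves[OF hb(1) elim(1)] mdist_triangle[of h "b n" "a n"] h(1) c s(1)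
          by (simp add: le_less_trans)
        show "snd (b, q) \<le> d n h w" if "w \<in> W m n" for w
        proof (rule ccontr)
          assume "\<not> snd (b, q) \<le> d n h w"
          then have "d n h w < r / 2"
            by (simp add: q_def not_le)
          then have "d n h (b n) + d n h w < r"
            using hb(2) ennreal_add_less_halves by blast
          moreover have "d n (b n) w \<le> d n h (b n) + d n h w"
            using mdist_triangle[of "b n" h w] mdist_commute[of "b n" h] W[of m n] that c h(1) by auto
          ultimately show False
            using elim(2) that by (meson leD le_less_trans)
        qed
      qed
    qed
    ultimately show ?thesis
      by blast
  qed
  have "good (\<one>\<^bsub>P\<^esub>, 1)"
    using monoid.one_closed[OF group.is_monoid[OF group_P]] by (simp add: good_def)
  then have "\<exists>t. good t" ..
  then obtain s where s: "\<And>m. good (s m)" "\<And>m. smaller m (s m) (s (Suc m))"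
    using dependent_nat_choice[of "\<lambda>_. good" smaller, OF _ step] by auto
  define B where "B m n h \<longleftrightarrow> d n h (fst (s m) n) < snd (s m)" for m n h
  have sC: "fst (s m) n \<in> carrier (G n)" for m n
    using s(1)[of m] unfolding good_def by (blast intro: component_closed)
  \<comment> \<open>Each inclusion holds only on U-many components. Intersecting the first
    \<open>m\<close> of these index sets is enough for finite satisfiability.\<close>
  have nested: "\<forall>\<^sub>F n in U. \<forall>h\<in>carrier (G n). B m n h \<longrightarrow> (\<forall>j\<le>m. B j n h)" for m
  proof (induction m)
    case (Suc m)
    have "\<forall>\<^sub>F n in U. \<forall>h\<in>carrier (G n). B (Suc m) n h \<longrightarrow> B m n h"
      using s(2)[of m] unfolding smaller_def B_def by (rule eventually_mono) blast
    with Suc show ?case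
      by eventually_elim (metis le_Suc_eq)
  qed simp
  have "\<forall>\<^sub>F n in U. \<exists>x\<in>carrier (G n). \<forall>j\<le>m. B j n x" for m
    using nested[of m]
  proof eventually_elim
    case (elim n)
    \<comment> \<open>The centre of the last ball lies in all the earlier ones.\<close>
    have "B m n (fst (s m) n)"
      using s(1)[of m] sC by (simp add: B_def good_def metric_group.mdist_self[OF metric_group])
    then show ?case
      using elim sC by blast
  qed
  with nonprincipal carrier_component_nonempty
  obtain h where h: "\<And>n. h n \<in> carrier (G n)" "\<And>m. \<forall>\<^sub>F n in U. B m n (h n)"
    by (rule saturation) blast
  have "far (W m) h" for m
  proof -
    \<comment> \<open>The shift to \<open>Suc m\<close> is there because the step from ball
      \<open>m\<close> to ball \<open>Suc m\<close> is the one that avoids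
      \<open>W m\<close>.\<close>
    have "\<forall>\<^sub>F n in U. \<forall>w\<in>W m n. snd (s (Suc m)) \<le> d n (h n) w"
      using s(2)[of m] h(2)[of "Suc m"] unfolding smaller_def
      by eventually_elim (use h(1) in \<open>auto simp: B_def\<close>)
    then show ?thesis
      using s(1)[of "Suc m"] by (auto simp: far_def good_def)
  qed
  then show False
    using cover[of h] h(1) by (auto simp: carrier_P_iff)
qed

section \<open>Covers by internal sets\<close>

theorem finite_union_square:
  fixes X :: "nat \<Rightarrow> (nat \<Rightarrow> 'a) set set"
  assumes int: "\<And>m. metrically_internal U G nrm (X m)"
    and cov: "carrier (metric_ultraproduct U G nrm) = (\<Union>m. X m)"
  shows "\<exists>N. carrier (metric_ultraproduct U G nrm)
           = (\<Union>m\<le>N. X m) <#>\<^bsub>metric_ultraproduct U G nrm\<^esub> (\<Union>m\<le>N. X m)"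
proof -
  have "\<forall>m. \<exists>Y. (\<forall>n. Y n \<subseteq> carrier (G n)) \<and> (\<forall>g\<in>carrier P. cls g \<in> X m \<longleftrightarrow> \<not> far Y g)"
    using metrically_internal_not_far[OF int] ..
  then obtain Y where
    "\<forall>m. (\<forall>n. Y m n \<subseteq> carrier (G n)) \<and> (\<forall>g\<in>carrier P. cls g \<in> X m \<longleftrightarrow> \<not> far (Y m) g)"
    by (rule choice[THEN exE])
  then have Y: "Y m n \<subseteq> carrier (G n)" "g \<in> carrier P \<Longrightarrow> cls g \<in> X m \<longleftrightarrow> \<not> far (Y m) g" for m n g
    by blast+
  define Z where "Z m = (\<Union>k\<le>m. X k)" for m
  \<comment> \<open>The componentwise unions \<open>W m\<close> represent the partial unions
    \<open>Z m\<close>.\<close>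
  define W where "W m n = (\<Union>k\<le>m. Y k n)" for m n
  have Z_iff: "cls g \<in> Z m \<longleftrightarrow> \<not> far (W m) g" if "g \<in> carrier P" for g m
    using far_UN_iff[OF finite_atMost, where Y = Y] Y(2)[OF that] by (auto simp: Z_def W_def[abs_def])
  have W: "W m n \<subseteq> carrier (G n)" for m n
    using Y(1) by (auto simp: W_def)
  have W_mono: "W m n \<subseteq> W (Suc m) n" for m n
    by (force simp: W_def)
  have cover: "\<exists>m. \<not> far (W m) g" if "g \<in> carrier P" for g
  proof -
    have "cls g \<in> (\<Union>m. X m)"
      using that cov by (auto simp: carrier_metric_ultraproduct)
    then obtain m where "cls g \<in> Z m"
      by (auto simp: Z_def)
    then show ?thesis
      using Z_iff that by blast
  qed
  obtain M a e where ball: "a \<in> carrier P" "e > 0"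
    "\<And>b. b \<in> carrier P \<Longrightarrow> \<forall>\<^sub>F n in U. d n (b n) (a n) < e \<Longrightarrow> \<not> far (W M) b"
    by (rule baire_ball[OF W cover]) (assumption, rule that)
  \<comment> \<open>The radius of the ball found above is the density required here.\<close>
  obtain m where dense: "\<forall>\<^sub>F n in U. \<forall>h\<in>carrier (G n). \<exists>w\<in>W m n. d n h w < e"
    by (rule eventually_dense[OF W_mono cover ball(2)])
  \<comment> \<open>Both factors must lie in \<open>Z N\<close>: one comes from the ball in
    \<open>Z M\<close>, the other from the dense set \<open>Z m\<close>.\<close>
  define N where "N = max M m"
  interpret P: group P
    by (rule group_P)
  interpret Q: group "metric_ultraproduct U G nrm"
    by (rule metric_ultraproduct_group) (rule metric_group)
  have Z_sub: "Z k \<subseteq> carrier (metric_ultraproduct U G nrm)" for k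
    using cov by (auto simp: Z_def)
  have Z_mono: "Z j \<subseteq> Z k" if "j \<le> k" for j k
    using that by (force simp: Z_def)
  have "carrier (metric_ultraproduct U G nrm) \<subseteq> Z N <#>\<^bsub>metric_ultraproduct U G nrm\<^esub> Z N"
  proof
    fix x assume "x \<in> carrier (metric_ultraproduct U G nrm)"
    then obtain g where g: "g \<in> carrier P" "x = cls g"
      by (auto simp: carrier_metric_ultraproduct)
    \<comment> \<open>The implication makes a choice possible at every \<open>n\<close>: where no
      approximant exists, any element of the carrier serves. Density confines such \<open>n\<close>
      to a U-negligible set.\<close>
    have "\<exists>v. v \<in> carrier (G n) \<and> ((\<exists>w\<in>W m n. d n (g n \<otimes>\<^bsub>G n\<^esub> inv\<^bsub>G n\<^esub> a n) w < e) \<longrightarrow>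
        v \<in> W m n \<and> d n (g n \<otimes>\<^bsub>G n\<^esub> inv\<^bsub>G n\<^esub> a n) v < e)" for n
    proof (cases "\<exists>w\<in>W m n. d n (g n \<otimes>\<^bsub>G n\<^esub> inv\<^bsub>G n\<^esub> a n) w < e")
      case True
      then show ?thesis
        using W[of m n] by blast
    next
      case False
      then show ?thesis
        using carrier_component_nonempty[of n] by blast
    qed
    then have "\<forall>n. \<exists>v. v \<in> carrier (G n) \<and> ((\<exists>w\<in>W m n. d n (g n \<otimes>\<^bsub>G n\<^esub> inv\<^bsub>G n\<^esub> a n) w < e) \<longrightarrow>
        v \<in> W m n \<and> d n (g n \<otimes>\<^bsub>G n\<^esub> inv\<^bsub>G n\<^esub> a n) v < e)" ..
    then obtain w where w: "\<forall>n. w n \<in> carrier (G n) \<and>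
        ((\<exists>v\<in>W m n. d n (g n \<otimes>\<^bsub>G n\<^esub> inv\<^bsub>G n\<^esub> a n) v < e) \<longrightarrow>
          w n \<in> W m n \<and> d n (g n \<otimes>\<^bsub>G n\<^esub> inv\<^bsub>G n\<^esub> a n) (w n) < e)"
      by (rule choice[THEN exE])
    have wP: "w \<in> carrier P"
      using w carrier_P_iff by blast
    have cc: "g n \<in> carrier (G n)" "a n \<in> carrier (G n)" for n
      using g(1) ball(1) by (blast intro: component_closed)+
    have close: "\<forall>\<^sub>F n in U. w n \<in> W m n \<and> d n (g n \<otimes>\<^bsub>G n\<^esub> inv\<^bsub>G n\<^esub> a n) (w n) < e"
      using dense
    proof eventually_elim
      case (elim n)
      interpret metric_group "G n" "nrm n"
        by (rule metric_group)
      show ?case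
        using elim cc[of n] w by simp
    qed
    \<comment> \<open>The second factor is forced by \<open>g = w b\<close>. By
      \<open>mdist_left_quotient\<close>, \<open>b n\<close> is as close to \<open>a n\<close> as
      \<open>w n\<close> is to \<open>g n\<close> times the inverse of \<open>a n\<close>.\<close>
    define b where "b = inv\<^bsub>P\<^esub> w \<otimes>\<^bsub>P\<^esub> g"
    have bP: "b \<in> carrier P"
      unfolding b_def using wP g(1) by (intro P.m_closed P.inv_closed)
    have "\<forall>\<^sub>F n in U. d n (b n) (a n) < e"
      using close
    proof eventually_elim
      case (elim n)
      interpret metric_group "G n" "nrm n"
        by (rule metric_group)
      have "b n = inv\<^bsub>G n\<^esub> w n \<otimes>\<^bsub>G n\<^esub> g n"
        unfolding b_def mult_P inv_P[OF wP] ..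
      then show ?case
        using elim mdist_left_quotient[of "g n" "w n" "a n"] cc[of n] w by simp
    qed
    then have "cls b \<in> Z N"
      using Z_iff[OF bP] ball(3)[OF bP] Z_mono[of M N] by (auto simp: N_def)
    moreover have "cls w \<in> Z N"
    proof -
      have "\<forall>\<^sub>F n in U. w n \<in> W m n"
        using close by (rule eventually_mono) blast
      then show ?thesis
        using Z_iff[OF wP] not_far_self[OF wP] Z_mono[of m N] by (auto simp: N_def)
    qed
    moreover have "x = cls w \<otimes>\<^bsub>metric_ultraproduct U G nrm\<^esub> cls b"
    proof -
      have "w \<otimes>\<^bsub>P\<^esub> b = g"
        unfolding b_def using wP g(1) P.inv_closed[OF wP] by (metis P.m_assoc P.r_inv P.l_one)
      then show ?thesis
        using class_mult[OF wP bP] g(2) by simp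
    qed
    ultimately show "x \<in> Z N <#>\<^bsub>metric_ultraproduct U G nrm\<^esub> Z N"
      unfolding set_mult_def by blast
  qed
  moreover have "Z N <#>\<^bsub>metric_ultraproduct U G nrm\<^esub> Z N \<subseteq> carrier (metric_ultraproduct U G nrm)"
    by (intro Q.set_mult_closed Z_sub)
  ultimately show ?thesis
    unfolding Z_def by blast
qed

end

theorem theorem3p1:
  fixes G :: "nat \<Rightarrow> ('a, 'm) monoid_scheme"
    and nrm :: "nat \<Rightarrow> 'a \<Rightarrow> ennreal"
    and U :: "nat filter"
    and X :: "nat \<Rightarrow> (nat \<Rightarrow> 'a) set set"
  assumes "\<And>n. metric_group (G n) (nrm n)"
    and "Sup {nrm n g | n g. g \<in> carrier (G n)} < \<infinity>"
    and "nonprincipal_ultrafilter U"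
    and "\<And>m. metrically_internal U G nrm (X m)"
    and "carrier (metric_ultraproduct U G nrm) = (\<Union>m. X m)"
  shows "\<exists>N. carrier (metric_ultraproduct U G nrm)
           = (\<Union>m\<le>N. X m) <#>\<^bsub>metric_ultraproduct U G nrm\<^esub> (\<Union>m\<le>N. X m)"
proof -
  interpret metric_group_sequence G nrm U
    using assms(1,3) by (rule metric_group_sequence.intro)
  show ?thesis
    using assms(4,5) by (rule finite_union_square)
qed

end
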